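(* The modified Fourier dimension is monotone and countably stable, and is bounded between the Fourier dimension and the Hausdorff dimension. That is: (a) if $A\subset B$ are Borel subsets of $\mathbb{R}^d$ then $\dim_{\mathrm{FM}}A\le\dim_{\mathrm{FM}}B$; (b) for every finite or countable family $\{A_k\}$ of Borel subsets of $\mathbb{R}^d$, $\dim_{\mathrm{FM}}\big(\bigcup_k A_k\big)=\sup_k\dim_{\mathrm{FM}}A_k$; (c) $\dim_{\mathrm{F}}A\le\dim_{\mathrm{FM}}A\le\dim_{\mathrm{H}}A$ for any Borel set $A\subset\mathbb{R}^d$.
   Context: For a finite Borel measure $\mu$ on $\mathbb{R}^d$, $\widehat\mu(\xi)=\int e^{-2\pi i \xi\cdot x}\,d\mu(x)$ for $\xi\in\mathbb{R}^d$. The notation $f(\xi)\lesssim g(\xi)$ means there is a constant $C$ with $|f(\xi)|\le C|g(\xi)|$ for all $\xi$ (negative powers of $|\xi|$ are read as $+\infty$ at $\xi=0$). The Fourier dimension of $\mu$ is $\dim_{\mathrm{F}}\mu=\sup\{s\in[0,d]:\ \widehat\mu(\xi)\lesssim|\xi|^{-s/2}\}$. For a Borel set $A\subset\mathbb{R}^d$, $\mathcal{P}(A)$ is the set of Borel probability measures $\mu$ on $\mathbb{R}^d$ with $\mu(A)=1$. The Fourier dimension of $A$ is $\dim_{\mathrm{F}}A=\sup\{\dim_{\mathrm{F}}\mu:\ \mu\in\mathcal{P}(A)\}$, and the modified Fourier dimension of $A$ is $\dim_{\mathrm{FM}}A=\sup\{\dim_{\mathrm{F}}\mu:\ \mu\in\mathcal{P}(\mathbb{R}^d),\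 \mu(A)>0\}$. Suprema of empty sets of dimensions are $0$. $\dim_{\mathrm{H}}$ denotes Hausdorff dimension. *)

theory Defs
  imports "HOL-Probability.Probability"
begin

text \<open>
  Throughout, \<open>\<real>\<^sup>d\<close> is a type \<open>'a :: euclidean_space\<close> with \<open>d = DIM('a)\<close>. Dimensions take values
  in \<^typ>\<open>ennreal\<close>, where the supremum of the empty set is \<open>0\<close>.
\<close>

definition borel_prob_measures :: "'a :: topological_space measure set" where
  "borel_prob_measures = {\<mu>. prob_space \<mu> \<and> sets \<mu> = sets borel}"

definition borel_prob_measures_on :: "'a :: topological_space set \<Rightarrow> 'a measure set" where
  "borel_prob_measures_on A = {\<mu> \<in> borel_prob_measures. measure \<mu> A = 1}"

definition fourier_transform :: "'a :: euclidean_space measure \<Rightarrow> 'a \<Rightarrow> complex" where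
  "fourier_transform \<mu> \<xi> =
     (LINT x|\<mu>. exp (- 2 * complex_of_real pi * \<i> * complex_of_real (\<xi> \<bullet> x)))"

text \<open>
  The point \<open>\<xi> = 0\<close> is left out: for \<open>s > 0\<close> the bound there is \<open>+\<infinity>\<close>, and for \<open>s = 0\<close> (where the
  bound should be the constant \<open>1\<close>, but \<open>0 powr 0 = 0\<close> in HOL) it only asks that
  \<open>fourier_transform \<mu> 0\<close> is finite, which can be absorbed into \<open>C\<close>.
\<close>

definition fourier_decay :: "'a :: euclidean_space measure \<Rightarrow> real \<Rightarrow> bool" where
  "fourier_decay \<mu> s \<longleftrightarrow>
     (\<exists>C. \<forall>\<xi>. \<xi> \<noteq> 0 \<longrightarrow> norm (fourier_transform \<mu> \<xi>) \<le> C * norm \<xi> powr (- s / 2))"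

definition fourier_dim_measure :: "'a :: euclidean_space measure \<Rightarrow> ennreal" where
  "fourier_dim_measure \<mu> = (SUP s \<in> {s \<in> {0..real DIM('a)}. fourier_decay \<mu> s}. ennreal s)"

definition fourier_dim :: "'a :: euclidean_space set \<Rightarrow> ennreal" where
  "fourier_dim A = (SUP \<mu> \<in> borel_prob_measures_on A. fourier_dim_measure \<mu>)"

definition modified_fourier_dim :: "'a :: euclidean_space set \<Rightarrow> ennreal" where
  "modified_fourier_dim A =
     (SUP \<mu> \<in> {\<mu> \<in> borel_prob_measures. measure \<mu> A > 0}. fourier_dim_measure \<mu>)"

text \<open>
  \<open>diam(U)\<^sup>s\<close> with the usual conventions \<open>diam(\<emptyset>)\<^sup>s = 0\<close> and \<open>diam(U)\<^sup>0 = 1\<close> for \<open>U \<noteq> \<emptyset>\<close>, so that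
  the \<open>0\<close>-dimensional Hausdorff measure is counting measure.
\<close>

definition diam_power :: "real \<Rightarrow> 'a :: metric_space set \<Rightarrow> ennreal" where
  "diam_power s U =
     (if U = {} then 0 else if s = 0 then 1 else ennreal (diameter U powr s))"

text \<open>Boundedness is required of the covering sets because \<^const>\<open>diameter\<close> has no meaningful value on
  unbounded sets.\<close>

definition hausdorff_premeasure ::
    "real \<Rightarrow> real \<Rightarrow> 'a :: metric_space set \<Rightarrow> ennreal" where
  "hausdorff_premeasure s \<delta> A =
     (INF U \<in> {U :: nat \<Rightarrow> 'a set.
                 A \<subseteq> (\<Union>i. U i) \<and> (\<forall>i. bounded (U i) \<and> diameter (U i) \<le> \<delta>)}.
        \<Sum>i. diam_power s (U i))"

definition hausdorff_measure :: "real \<Rightarrow> 'a :: metric_space set \<Rightarrow> ennreal" where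
  "hausdorff_measure s A = (SUP \<delta> \<in> {0<..}. hausdorff_premeasure s \<delta> A)"

definition hausdorff_dim :: "'a :: metric_space set \<Rightarrow> ennreal" where
  "hausdorff_dim A = (INF s \<in> {s. 0 \<le> s \<and> hausdorff_measure s A = 0}. ennreal s)"

end

theory Submission
  imports Defs
begin

text \<open>
  Monotonicity, countable stability and \<open>dim\<^sub>F \<le> dim\<^sub>F\<^sub>M\<close> are immediate, because a
  countable union of \<open>\<mu>\<close>-null sets is \<open>\<mu>\<close>-null. For \<open>dim\<^sub>F\<^sub>M \<le> dim\<^sub>H\<close>, suppose that
  the Fourier transform of \<open>\<mu>\<close> is \<open>O(\<bar>\<xi>\<bar>\<^sup>-\<^sup>s\<^sup>/\<^sup>2)\<close> with \<open>s < d\<close>, and let \<open>G\<close> be a standard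
  Gaussian vector. Since \<open>exp (-\<bar>z\<bar>\<^sup>2/2r\<^sup>2)\<close> is the characteristic function of \<open>G/r\<close> at \<open>z\<close>,
  its double integral against \<open>\<mu> \<times> \<mu>\<close> (with \<open>z = x - y\<close>) is the expectation of the squared
  modulus of the Fourier transform at \<open>-G/2\<pi>r\<close>. This is \<open>O(r\<^sup>s)\<close>, because
  \<open>\<bar>G\<bar>\<^sup>-\<^sup>s\<close> has finite mean. Hence \<open>\<integral> \<mu>(B(x,r)) d\<mu>(x) = O(r\<^sup>s)\<close>. Summing over dyadic \<open>r\<close>
  shows that for \<open>t < s\<close> and \<open>\<mu>\<close>-almost every \<open>x\<close> the measure of \<open>B(x,2\<^sup>-\<^sup>k)\<close> is
  \<open>O(2\<^sup>-\<^sup>k\<^sup>t)\<close>, and by the mass distribution principle a set of \<open>t\<close>-dimensional Hausdorff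
  measure zero is then \<open>\<mu>\<close>-null.
\<close>

section \<open>Gaussian vectors: characteristic function and negative moments\<close>

text \<open>The singularity at 0 is integrable because \<open>a < 1\<close>; away from [-1,1] the
  power is at most 1 and the density alone dominates.\<close>

lemma nn_integral_std_normal_powr_finite:
  fixes a :: real
  assumes "0 \<le> a" "a < 1"
  shows "(\<integral>\<^sup>+x. ennreal (\<bar>x\<bar> powr (-a)) \<partial>std_normal_distribution) < \<infinity>"
proof -
  \<comment> \<open>\<open>h\<close> carries the right half of the singularity,
    \<open>h (-x)\<close> the left half.\<close>
  define h :: "real \<Rightarrow> ennreal" where "h x = ennreal (indicator {0..1} x * x powr (-a))" for x
  have [measurable]: "h \<in> borel_measurable borel" unfolding h_def by measurable
  have h: "(\<integral>\<^sup>+x. h x \<partial>lborel) = ennreal (1 / (1 - a))"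
    using nn_integral_has_integral_lebesgue[OF _ has_integral_powr_from_0[of "-a" 1]] assms
    by (simp add: h_def)
  have h': "(\<integral>\<^sup>+x. h (-x) \<partial>lborel) = (\<integral>\<^sup>+x. h x \<partial>lborel)"
    by (subst nn_integral_real_affine[of h "-1" 0]) auto
  have "std_normal_density x \<le> 1" for x
  proof -
    have "exp (- (x\<^sup>2 / 2)) \<le> 1" "1 \<le> sqrt (2 * pi)" using pi_gt3 by simp_all
    then have "exp (- (x\<^sup>2 / 2)) \<le> sqrt (2 * pi)" by linarith
    then show ?thesis
      unfolding normal_density_def by (simp add: divide_simps)
  qed
  then have le: "ennreal (std_normal_density x) * ennreal (\<bar>x\<bar> powr (-a))
      \<le> h x + h (-x) + ennreal (std_normal_density x)" for x
  proof (cases "\<bar>x\<bar> \<le> 1")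
    case True
    have "ennreal (std_normal_density x) * ennreal (\<bar>x\<bar> powr (-a)) \<le> 1 * ennreal (\<bar>x\<bar> powr (-a))"
      using \<open>std_normal_density x \<le> 1\<close> by (intro mult_right_mono) (auto simp: ennreal_le_1)
    also have "\<dots> \<le> h x + h (-x)"
      using True by (cases "0 \<le> x") (auto simp: h_def indicator_def)
    finally show ?thesis by (meson add_increasing2 order_trans zero_le)
  next
    case False
    then have "\<bar>x\<bar> powr (-a) \<le> 1"
      using assms powr_mono[of "-a" 0 "\<bar>x\<bar>"] by (auto split: if_splits)
    then have "ennreal (std_normal_density x) * ennreal (\<bar>x\<bar> powr (-a))
        \<le> ennreal (std_normal_density x) * 1"
      by (intro mult_left_mono) auto
    then show ?thesis by (simp add: add_increasing)
  qed
  have "(\<integral>\<^sup>+x. ennreal (\<bar>x\<bar> powr (-a)) \<partial>std_normal_distribution)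
      = (\<integral>\<^sup>+x. ennreal (std_normal_density x) * ennreal (\<bar>x\<bar> powr (-a)) \<partial>lborel)"
    by (subst nn_integral_density) auto
  also have "\<dots> \<le> (\<integral>\<^sup>+x. h x + h (-x) + ennreal (std_normal_density x) \<partial>lborel)"
    by (intro nn_integral_mono le)
  also have "\<dots> = ennreal (1 / (1 - a)) + ennreal (1 / (1 - a)) + emeasure std_normal_distribution UNIV"
    by (subst nn_integral_add, measurable, subst nn_integral_add)
       (auto simp: h h' emeasure_density)
  also have "\<dots> < \<infinity>"
    using prob_space.emeasure_space_1[OF prob_space_normal_density[of 1 0]] by simp
  finally show ?thesis .
qed

text \<open>Built from independent coordinates rather than from a density, so that integrals of
  functions that factor over the coordinates become products.\<close>

definition std_gaussian :: "'a :: euclidean_space measure" where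
  "std_gaussian = distr (\<Pi>\<^sub>M b\<in>(Basis :: 'a set). std_normal_distribution) borel (\<lambda>f. \<Sum>b\<in>Basis. f b *\<^sub>R b)"

lemma prob_space_std_normal: "prob_space std_normal_distribution"
  by (rule prob_space_normal_density) simp

lemma measurable_sum_Basis [measurable]:
  "(\<lambda>f. \<Sum>b\<in>(Basis :: 'a :: euclidean_space set). f b *\<^sub>R b)
     \<in> borel_measurable (\<Pi>\<^sub>M b\<in>(Basis :: 'a set). std_normal_distribution)"
  by (intro borel_measurable_sum borel_measurable_scaleR)
     (auto intro!: measurable_compose[OF measurable_component_singleton])

lemma sets_std_gaussian [measurable_cong, simp]: "sets std_gaussian = sets borel"
  by (simp add: std_gaussian_def)

lemma prob_space_std_gaussian: "prob_space std_gaussian"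
  unfolding std_gaussian_def
  by (intro prob_space.prob_space_distr prob_space_PiM prob_space_std_normal) measurable

lemma product_sigma_finite_std_normal: "product_sigma_finite (\<lambda>_. std_normal_distribution)"
  by (simp add: product_sigma_finite_def prob_space_imp_sigma_finite prob_space_std_normal)

text \<open>The exponential factors over the coordinates, and each factor integrates to a
  one-dimensional normal characteristic function.\<close>

lemma integral_std_gaussian_exp:
  fixes z :: "'a :: euclidean_space"
  shows "(LINT g|std_gaussian. exp (\<i> * complex_of_real (z \<bullet> g))) = complex_of_real (exp (- (norm z)\<^sup>2 / 2))"
proof -
  interpret product_sigma_finite "\<lambda>_ :: 'a. std_normal_distribution"
    by (rule product_sigma_finite_std_normal)
  interpret N: prob_space std_normal_distribution by (rule prob_space_std_normal)
  have "(LINT g|std_gaussian. exp (\<i> * complex_of_real (z \<bullet> g)))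
      = (LINT f|(\<Pi>\<^sub>M b\<in>(Basis :: 'a set). std_normal_distribution).
           (\<Prod>b\<in>Basis. exp (\<i> * complex_of_real ((z \<bullet> b) * f b))))"
    unfolding std_gaussian_def
    by (subst integral_distr)
       (auto simp: inner_sum_right exp_sum[symmetric] sum_distrib_left mult_ac)
  also have "\<dots> = (\<Prod>b\<in>Basis. char std_normal_distribution (z \<bullet> b))"
    unfolding char_def
    by (subst product_integral_prod)
       (auto intro!: N.integrable_const_bound[of _ 1] simp: norm_exp_i_times)
  also have "\<dots> = complex_of_real (exp (\<Sum>b\<in>Basis. - (z \<bullet> b)\<^sup>2 / 2))"
    by (simp add: char_std_normal_distribution exp_sum)
  also have "(\<Sum>b\<in>Basis. - (z \<bullet> b)\<^sup>2 / 2) = - (norm z)\<^sup>2 / 2"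
    by (simp add: norm_eq_sqrt_inner euclidean_inner[of z z] sum_nonneg power2_eq_square sum_negf
        flip: sum_divide_distrib)
  finally show ?thesis .
qed

lemma AE_std_normal_nonzero: "AE x in std_normal_distribution. x \<noteq> 0"
proof -
  have "AE x in lborel. x \<noteq> (0::real)"
    by (rule AE_lborel_singleton)
  then show ?thesis by (subst AE_density) (auto elim: eventually_mono)
qed

text \<open>Needed because \<open>fourier_decay\<close> gives no bound at frequency 0. A single
  coordinate already avoids 0 almost surely.\<close>

lemma AE_std_gaussian_nonzero: "AE g in std_gaussian. (g :: 'a :: euclidean_space) \<noteq> 0"
proof -
  obtain b :: 'a where b: "b \<in> Basis" using nonempty_Basis by blast
  have "AE f in (\<Pi>\<^sub>M b\<in>(Basis :: 'a set). std_normal_distribution). f b \<noteq> 0"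
    using b by (intro AE_PiM_component prob_space_std_normal AE_std_normal_nonzero)
  then show ?thesis
    unfolding std_gaussian_def
    by (subst AE_distr_iff) (use b in \<open>auto elim!: eventually_mono dest: arg_cong[of _ _ "\<lambda>x. x \<bullet> b"]\<close>)
qed

text \<open>Every coordinate is bounded by the norm, so the negative power of the norm is at most a
  product of negative powers of the coordinates, and this product integrates factor by
  factor.\<close>

lemma nn_integral_std_gaussian_powr_finite:
  fixes s :: real
  assumes "0 \<le> s" "s < DIM('a :: euclidean_space)"
  shows "(\<integral>\<^sup>+g. ennreal (norm (g :: 'a) powr (-s)) \<partial>std_gaussian) < \<infinity>"
proof -
  interpret product_sigma_finite "\<lambda>_ :: 'a. std_normal_distribution"
    by (rule product_sigma_finite_std_normal)
  \<comment> \<open>The exponent is shared equally among the coordinates, which turns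
    \<open>s < d\<close> into the one-dimensional condition \<open>a < 1\<close>.\<close>
  define a where "a = s / DIM('a)"
  have a: "0 \<le> a" "a < 1" using assms by (auto simp: a_def)
  let ?P = "\<Pi>\<^sub>M b\<in>(Basis :: 'a set). std_normal_distribution"
  let ?v = "\<lambda>f. (\<Sum>b\<in>Basis. f b *\<^sub>R b) :: 'a"
  have bound: "norm (?v f) powr (-s) \<le> (\<Prod>b\<in>Basis. \<bar>f b\<bar> powr (-a))"
    if f: "\<forall>b\<in>Basis. f b \<noteq> 0" for f :: "'a \<Rightarrow> real"
  proof -
    have le: "\<bar>f b\<bar> \<le> norm (?v f)" if "b \<in> Basis" for b
      using Basis_le_norm[OF that, of "?v f"] that by simp
    obtain b :: 'a where b: "b \<in> Basis" using nonempty_Basis by blast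
    have pos: "norm (?v f) > 0" using le[OF b] f b by fastforce
    have "norm (?v f) powr (-s) = (\<Prod>b\<in>(Basis :: 'a set). norm (?v f) powr (-a))"
      using pos by (simp add: a_def powr_power)
    also have "\<dots> \<le> (\<Prod>b\<in>Basis. \<bar>f b\<bar> powr (-a))"
      using le f a by (intro prod_mono conjI powr_mono2') auto
    finally show ?thesis .
  qed
  have ae: "AE f in ?P. \<forall>b\<in>Basis. f b \<noteq> 0"
    by (intro eventually_ball_finite ballI AE_PiM_component prob_space_std_normal
        AE_std_normal_nonzero) auto
  have "(\<integral>\<^sup>+g. ennreal (norm (g :: 'a) powr (-s)) \<partial>std_gaussian)
      = (\<integral>\<^sup>+f. ennreal (norm (?v f) powr (-s)) \<partial>?P)"
    unfolding std_gaussian_def by (subst nn_integral_distr) auto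
  also have "\<dots> \<le> (\<integral>\<^sup>+f. (\<Prod>b\<in>Basis. ennreal (\<bar>f b\<bar> powr (-a))) \<partial>?P)"
    using ae by (intro nn_integral_mono_AE)
      (auto elim!: eventually_mono intro!: ennreal_leI bound simp: prod_ennreal)
  also have "\<dots> = (\<Prod>b\<in>(Basis :: 'a set). \<integral>\<^sup>+x. ennreal (\<bar>x\<bar> powr (-a)) \<partial>std_normal_distribution)"
    by (rule product_nn_integral_prod) auto
  also have "\<dots> < \<infinity>"
    using nn_integral_std_normal_powr_finite[OF a] by (simp add: power_less_top_ennreal)
  finally show ?thesis .
qed

section \<open>Fourier decay and the average mass of balls\<close>

context
  fixes \<mu> :: "'a :: euclidean_space measure"
  assumes prob: "prob_space \<mu>" and sets_mu [measurable_cong, simp]: "sets \<mu> = sets borel"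
begin

lemma norm_fourier_transform_le_1: "norm (fourier_transform \<mu> \<xi>) \<le> 1"
proof -
  interpret prob_space \<mu> by (rule prob)
  have "norm (fourier_transform \<mu> \<xi>) \<le> (LINT x|\<mu>. norm (exp (- 2 * complex_of_real pi * \<i> * complex_of_real (\<xi> \<bullet> x))))"
    unfolding fourier_transform_def by (rule integral_norm_bound)
  also have "\<dots> = 1"
    by (simp add: norm_exp_eq_Re prob_space)
  finally show ?thesis .
qed

text \<open>Inside the unit ball the trivial bound 1 suffices, since the power there is at least 1;
  outside it, the smaller exponent gives the weaker bound. The constant \<open>max 1 C\<close>
  serves both regions.\<close>

lemma fourier_decay_mono:
  assumes "fourier_decay \<mu> s" "0 \<le> t" "t \<le> s"
  shows "fourier_decay \<mu> t"
proof -
  obtain C where C: "\<And>\<xi>. \<xi> \<noteq> 0 \<Longrightarrow> norm (fourier_transform \<mu> \<xi>) \<le> C * norm \<xi> powr (- s / 2)"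
    using assms(1) unfolding fourier_decay_def by blast
  have "norm (fourier_transform \<mu> \<xi>) \<le> max 1 C * norm \<xi> powr (- t / 2)" if "\<xi> \<noteq> 0" for \<xi>
  proof (cases "norm \<xi> \<le> 1")
    case True
    have "1 \<le> norm \<xi> powr (- t / 2)"
      using powr_mono2'[of "- t / 2" "norm \<xi>" 1] True that assms by simp
    then have "1 * 1 \<le> max 1 C * norm \<xi> powr (- t / 2)"
      by (intro mult_mono) auto
    then show ?thesis using norm_fourier_transform_le_1[of \<xi>] by linarith
  next
    case False
    have "C * norm \<xi> powr (- s / 2) \<le> max 1 C * norm \<xi> powr (- t / 2)"
      using False assms by (intro mult_mono powr_mono) auto
    then show ?thesis using C[OF that] by linarith
  qed
  then show ?thesis unfolding fourier_decay_def by blast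
qed

text \<open>The character of a difference is a character times a conjugate, so the double integral
  splits. The argument \<open>- (v /\<^sub>R (2 * pi))\<close> undoes the sign and the factor 2 pi
  in \<open>fourier_transform\<close>.\<close>

lemma integral_pair_exp_eq_norm_power2:
  "(LINT p|(\<mu> \<Otimes>\<^sub>M \<mu>). exp (\<i> * complex_of_real (v \<bullet> (fst p - snd p))))
     = complex_of_real ((norm (fourier_transform \<mu> (- (v /\<^sub>R (2 * pi)))))\<^sup>2)"
proof -
  interpret prob_space \<mu> by (rule prob)
  interpret P: pair_prob_space \<mu> \<mu> ..
  let ?e = "\<lambda>x. exp (\<i> * complex_of_real (v \<bullet> x))"
  have ft: "fourier_transform \<mu> (- (v /\<^sub>R (2 * pi))) = (LINT x|\<mu>. ?e x)"
    unfolding fourier_transform_def by (simp add: field_simps)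
  have "(LINT p|(\<mu> \<Otimes>\<^sub>M \<mu>). exp (\<i> * complex_of_real (v \<bullet> (fst p - snd p))))
      = (LINT x|\<mu>. LINT y|\<mu>. ?e (x - y))"
    by (subst P.integral_fst'[symmetric])
       (auto intro!: P.P.integrable_const_bound[of _ 1] simp: norm_exp_i_times)
  also have "\<dots> = (LINT x|\<mu>. LINT y|\<mu>. ?e x * cnj (?e y))"
    by (simp add: inner_diff_right right_diff_distrib exp_diff exp_minus exp_cnj divide_inverse)
  also have "\<dots> = (LINT x|\<mu>. ?e x) * cnj (LINT y|\<mu>. ?e y)"
    by simp
  also have "\<dots> = complex_of_real ((norm (LINT x|\<mu>. ?e x))\<^sup>2)"
    by (rule complex_norm_square[symmetric])
  finally show ?thesis by (simp only: ft)
qed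

lemma borel_measurable_fourier_transform [measurable]:
  "fourier_transform \<mu> \<in> borel_measurable borel"
proof -
  interpret prob_space \<mu> by (rule prob)
  show ?thesis
    unfolding fourier_transform_def[abs_def] by measurable
qed

text \<open>Parseval's identity for a Gaussian kernel, which avoids Fourier inversion: the kernel is
  itself the characteristic function of a Gaussian vector, so Fubini suffices.\<close>

lemma integral_pair_gaussian:
  assumes "r > 0"
  shows "(LINT p|(\<mu> \<Otimes>\<^sub>M \<mu>). exp (- (dist (fst p) (snd p) / r)\<^sup>2 / 2))
     = (LINT g|std_gaussian. (norm (fourier_transform \<mu> (- (g /\<^sub>R (2 * pi * r)))))\<^sup>2)"
proof -
  interpret prob_space \<mu> by (rule prob)
  interpret P: pair_prob_space \<mu> \<mu> ..
  interpret G: prob_space "std_gaussian :: 'a measure" by (rule prob_space_std_gaussian)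
  interpret PG: pair_prob_space "\<mu> \<Otimes>\<^sub>M \<mu>" "std_gaussian :: 'a measure" ..
  have scale: "dist x y / r = norm ((x - y) /\<^sub>R r)" for x y :: 'a
    using assms by (simp add: dist_norm divide_inverse_commute)
  have "complex_of_real (LINT p|(\<mu> \<Otimes>\<^sub>M \<mu>). exp (- (dist (fst p) (snd p) / r)\<^sup>2 / 2))
      = (LINT p|(\<mu> \<Otimes>\<^sub>M \<mu>). complex_of_real (exp (- (norm ((fst p - snd p) /\<^sub>R r))\<^sup>2 / 2)))"
    unfolding scale by (rule integral_complex_of_real[symmetric])
  also have "\<dots> = (LINT p|(\<mu> \<Otimes>\<^sub>M \<mu>). LINT g|std_gaussian.
                    exp (\<i> * complex_of_real (((fst p - snd p) /\<^sub>R r) \<bullet> g)))"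
    by (simp only: integral_std_gaussian_exp)
  also have "\<dots> = (LINT g|std_gaussian. LINT p|(\<mu> \<Otimes>\<^sub>M \<mu>).
                    exp (\<i> * complex_of_real (((fst p - snd p) /\<^sub>R r) \<bullet> g)))"
    by (rule PG.Fubini_integral[symmetric])
       (auto intro!: PG.P.integrable_const_bound[of _ 1] simp: norm_exp_i_times split_beta)
  also have "\<dots> = (LINT g|std_gaussian. LINT p|(\<mu> \<Otimes>\<^sub>M \<mu>).
                    exp (\<i> * complex_of_real ((g /\<^sub>R r) \<bullet> (fst p - snd p))))"
    by (simp add: inner_commute)
  also have "\<dots> = (LINT g|std_gaussian.
        complex_of_real ((norm (fourier_transform \<mu> (- (g /\<^sub>R (2 * pi * r)))))\<^sup>2))"
    by (simp only: integral_pair_exp_eq_norm_power2 scaleR_scaleR) (simp add: mult.commute)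
  finally show ?thesis
    by (simp only: integral_complex_of_real of_real_eq_iff)
qed

text \<open>The indicator of a ball is dominated by a Gaussian kernel of width \<open>r\<close>. The
  Parseval identity turns the kernel integral into a Gaussian mean of the squared transform; the
  decay bound then releases the factor \<open>r powr s\<close> and leaves a negative moment, finite
  because \<open>s < d\<close>.\<close>

lemma nn_integral_ball_le:
  assumes decay: "fourier_decay \<mu> s" and s: "0 \<le> s" "s < DIM('a)"
  obtains K where "K < \<infinity>"
    "\<And>r. r > 0 \<Longrightarrow> (\<integral>\<^sup>+x. emeasure \<mu> (ball x r) \<partial>\<mu>) \<le> K * ennreal (r powr s)"
proof -
  interpret prob_space \<mu> by (rule prob)
  interpret P: pair_prob_space \<mu> \<mu> ..
  interpret G: prob_space "std_gaussian :: 'a measure" by (rule prob_space_std_gaussian)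
  obtain C where C: "\<And>\<xi>. \<xi> \<noteq> 0 \<Longrightarrow> norm (fourier_transform \<mu> \<xi>) \<le> C * norm \<xi> powr (- s / 2)"
    using decay unfolding fourier_decay_def by blast
  define J where "J = (\<integral>\<^sup>+g. ennreal (norm (g :: 'a) powr (-s)) \<partial>std_gaussian)"
  define D where "D = exp (1/2) * (C\<^sup>2 * (2 * pi) powr s)"
  have D: "D \<ge> 0" by (simp add: D_def)
  show thesis
  proof (rule that)
    show "ennreal D * J < \<infinity>"
      using nn_integral_std_gaussian_powr_finite[OF s] by (simp add: J_def ennreal_mult_less_top)
    fix r :: real assume r: "r > 0"
    let ?k = "\<lambda>p. exp (- (dist (fst p) (snd p :: 'a) / r)\<^sup>2 / 2)"
    let ?F = "\<lambda>g. (norm (fourier_transform \<mu> (- (g /\<^sub>R (2 * pi * r)))))\<^sup>2"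
    \<comment> \<open>Within distance \<open>r\<close> the kernel is at least
      \<open>exp (-1/2)\<close>, whence the factor \<open>exp (1/2)\<close>.\<close>
    have ball: "indicator (ball x r) y \<le> ennreal (exp (1/2)) * ennreal (?k (x, y))" for x y
    proof (cases "y \<in> ball x r")
      case True
      then have "(dist x y / r)\<^sup>2 \<le> 1"
        using r by (intro power_le_one) auto
      then have "exp 0 \<le> exp (1/2 + (- (dist x y / r)\<^sup>2 / 2))" by (subst exp_le_cancel_iff) simp
      then have "1 \<le> exp (1/2) * ?k (x, y)" by (simp only: exp_add exp_zero fst_conv snd_conv)
      then show ?thesis using True by (simp flip: ennreal_mult)
    qed simp
    have F: "?F g \<le> C\<^sup>2 * (2 * pi) powr s * r powr s * norm g powr (-s)" if "g \<noteq> 0" for g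
    proof -
      have "?F g \<le> (C * norm (g /\<^sub>R (2 * pi * r)) powr (- s / 2))\<^sup>2"
        using C[of "- (g /\<^sub>R (2 * pi * r))"] that r by (intro power_mono) auto
      also have "\<dots> = C\<^sup>2 * norm (g /\<^sub>R (2 * pi * r)) powr (- s)"
        by (simp add: power_mult_distrib power2_eq_square flip: powr_add)
      also have "norm (g /\<^sub>R (2 * pi * r)) powr (- s) = (2 * pi) powr s * r powr s * norm g powr (-s)"
        using r that by (simp add: powr_mult powr_minus inverse_powr powr_divide field_simps)
      finally show ?thesis by (simp add: mult_ac)
    qed
    have "(\<integral>\<^sup>+x. emeasure \<mu> (ball x r) \<partial>\<mu>) = (\<integral>\<^sup>+x. \<integral>\<^sup>+y. indicator (ball x r) y \<partial>\<mu> \<partial>\<mu>)"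
      by simp
    also have "\<dots> \<le> (\<integral>\<^sup>+x. \<integral>\<^sup>+y. ennreal (exp (1/2)) * ennreal (?k (x, y)) \<partial>\<mu> \<partial>\<mu>)"
      by (intro nn_integral_mono ball)
    also have "\<dots> = ennreal (exp (1/2)) * (\<integral>\<^sup>+p. ennreal (?k p) \<partial>(\<mu> \<Otimes>\<^sub>M \<mu>))"
      by (subst nn_integral_fst) (auto intro!: nn_integral_cmult)
    also have "(\<integral>\<^sup>+p. ennreal (?k p) \<partial>(\<mu> \<Otimes>\<^sub>M \<mu>)) = ennreal (LINT p|(\<mu> \<Otimes>\<^sub>M \<mu>). ?k p)"
      by (intro nn_integral_eq_integral P.P.integrable_const_bound[of _ 1]) auto
    also have "(LINT p|(\<mu> \<Otimes>\<^sub>M \<mu>). ?k p) = (LINT g|std_gaussian. ?F g)"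
      by (rule integral_pair_gaussian[OF r])
    also have "ennreal \<dots> = (\<integral>\<^sup>+g. ennreal (?F g) \<partial>std_gaussian)"
      by (intro nn_integral_eq_integral[symmetric] G.integrable_const_bound[of _ 1])
         (auto intro!: power_le_one norm_fourier_transform_le_1)
    also have "\<dots> \<le> (\<integral>\<^sup>+g. ennreal (C\<^sup>2 * (2 * pi) powr s * r powr s) * ennreal (norm (g :: 'a) powr (-s)) \<partial>std_gaussian)"
    proof (rule nn_integral_mono_AE)
      show "AE g in std_gaussian. ennreal (?F g)
          \<le> ennreal (C\<^sup>2 * (2 * pi) powr s * r powr s) * ennreal (norm g powr (-s))"
        using AE_std_gaussian_nonzero[where 'a = 'a]
      proof eventually_elim
        case (elim g)
        show ?case using ennreal_leI[OF F[OF elim]] by (simp flip: ennreal_mult)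
      qed
    qed
    also have "\<dots> = ennreal (C\<^sup>2 * (2 * pi) powr s * r powr s) * J"
      unfolding J_def by (rule nn_integral_cmult) measurable
    also have "ennreal (exp (1/2)) * (ennreal (C\<^sup>2 * (2 * pi) powr s * r powr s) * J) = ennreal D * J * ennreal (r powr s)"
      by (simp add: D_def ennreal_mult mult_ac)
    finally show "(\<integral>\<^sup>+x. emeasure \<mu> (ball x r) \<partial>\<mu>) \<le> ennreal D * J * ennreal (r powr s)"
      by (simp add: mult_left_mono)
  qed
qed

end

section \<open>The mass distribution principle\<close>

text \<open>Take the predecessor of the first exponent whose power is at most \<open>D\<close>; it
  exists because \<open>D < 1\<close>.\<close>

lemma dyadic_scale:
  fixes D :: real
  assumes "0 < D" "D < 1"
  obtains k where "D < (1/2) ^ k" "(1/2) ^ k \<le> 2 * D"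
proof -
  define n where "n = (LEAST n. (1/2 :: real) ^ n \<le> D)"
  obtain m where "(1/2 :: real) ^ m < D" using real_arch_pow_inv[of D "1/2"] assms by auto
  then have n: "(1/2 :: real) ^ n \<le> D"
    using LeastI[of "\<lambda>n. (1/2 :: real) ^ n \<le> D" m] by (simp add: n_def)
  then have "n \<noteq> 0" using assms by (intro notI) simp
  then obtain k where k: "n = Suc k" by (cases n) auto
  have "\<not> (1/2 :: real) ^ k \<le> D" using not_less_Least[of k "\<lambda>n. (1/2 :: real) ^ n \<le> D"] k n_def by simp
  then show thesis using that[of k] n k by simp
qed

text \<open>Growth is known only at dyadic radii; rounding the diameter up to one of them costs at
  most a factor 2, hence \<open>2 powr t\<close>. The degenerate values of \<open>diam_power\<close>
  need separate cases.\<close>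

lemma emeasure_le_diam_power:
  fixes \<mu> :: "'a :: euclidean_space measure"
  assumes sets_mu: "sets \<mu> = sets borel"
    and t: "0 \<le> t"
    and growth: "\<And>k. emeasure \<mu> (ball x ((1/2) ^ k)) \<le> ennreal (M * ((1/2) ^ k) powr t)"
    and U: "x \<in> U" "bounded U" "diameter U \<le> 1/2" and M: "0 \<le> M"
  shows "emeasure \<mu> (cball x (diameter U)) \<le> ennreal (M * 2 powr t) * diam_power t U"
proof -
  have D0: "0 \<le> diameter U" using diameter_ge_0[OF U(2)] .
  have le: "emeasure \<mu> (cball x (diameter U)) \<le> ennreal (M * ((1/2) ^ k) powr t)"
    if "diameter U < (1/2) ^ k" for k
  proof -
    have "emeasure \<mu> (cball x (diameter U)) \<le> emeasure \<mu> (ball x ((1/2) ^ k))"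
      using that sets_mu by (intro emeasure_mono) auto
    then show ?thesis using growth[of k] by (rule order_trans)
  qed
  consider "t = 0" | "t > 0" "diameter U = 0" | "t > 0" "diameter U > 0"
    using t D0 by linarith
  then show ?thesis
  proof cases
    case 1
    \<comment> \<open>Here \<open>diam_power\<close> is 1, and the ball of radius 1 already gives
      the bound \<open>M\<close>.\<close>
    then show ?thesis using le[of 0] U by (auto simp: diam_power_def)
  next
    case 2
    \<comment> \<open>Now \<open>diam_power\<close> is 0, so the point itself must have mass 0; let
      the dyadic radii shrink.\<close>
    have "(\<lambda>k. M * ((1/2) powr t) ^ k) \<longlonglongrightarrow> M * 0"
      using 2 by (intro tendsto_mult tendsto_const LIMSEQ_realpow_zero) (auto simp: powr01_less_one)
    then have "(\<lambda>k. ennreal (M * ((1/2) ^ k) powr t)) \<longlonglongrightarrow> ennreal 0"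
      by (intro tendsto_ennrealI) (simp add: powr_powr powr_power mult.commute flip: powr_realpow)
    then have "emeasure \<mu> (cball x (diameter U)) \<le> ennreal 0"
      using 2 le by (intro LIMSEQ_le_const) auto
    then show ?thesis by simp
  next
    case 3
    obtain k where k: "diameter U < (1/2) ^ k" "(1/2) ^ k \<le> 2 * diameter U"
      using dyadic_scale[of "diameter U"] 3 U by auto
    have "((1/2) ^ k) powr t \<le> (2 * diameter U) powr t"
      using k t by (intro powr_mono2) auto
    then have "M * ((1/2) ^ k) powr t \<le> M * 2 powr t * diameter U powr t"
      using M D0 by (simp add: powr_mult mult.assoc mult_left_mono)
    then have "emeasure \<mu> (cball x (diameter U)) \<le> ennreal (M * 2 powr t * diameter U powr t)"
      using le[OF k(1)] by (meson ennreal_leI order_trans)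
    also have "\<dots> = ennreal (M * 2 powr t) * diam_power t U"
      using 3 U M by (auto simp: diam_power_def ennreal_mult)
    finally show ?thesis .
  qed
qed

text \<open>A cover with small total \<open>diam_power\<close> is traded for a cover by balls
  centred in \<open>S\<close>, where the growth bound applies.\<close>

lemma null_set_mass_distribution:
  fixes \<mu> :: "'a :: euclidean_space measure"
  assumes sets_mu: "sets \<mu> = sets borel"
    and t: "0 \<le> t" and M: "0 \<le> M"
    and growth: "\<And>x k. x \<in> S \<Longrightarrow> emeasure \<mu> (ball x ((1/2) ^ k)) \<le> ennreal (M * ((1/2) ^ k) powr t)"
    and S: "S \<in> sets borel" "hausdorff_measure t S = 0"
  shows "emeasure \<mu> S = 0"
proof -
  \<comment> \<open>The scale 1/2 matches the diameter bound of
    \<open>emeasure_le_diam_power\<close>.\<close>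
  have "hausdorff_premeasure t (1/2) S \<le> hausdorff_measure t S"
    unfolding hausdorff_measure_def by (rule SUP_upper) simp
  then have H: "hausdorff_premeasure t (1/2) S = 0" using S by simp
  have small: "emeasure \<mu> S \<le> 0 + ennreal e" if "e > 0" for e :: real
  proof -
    define c where "c = M * 2 powr t"
    have c: "c \<ge> 0" using M by (simp add: c_def)
    \<comment> \<open>Dividing by \<open>c + 1\<close> rather than \<open>c\<close> allows
      \<open>c = 0\<close>.\<close>
    have "hausdorff_premeasure t (1/2) S < ennreal (e / (c + 1))"
      using H that c by simp
    then obtain U where U: "S \<subseteq> (\<Union>i. U i)" "\<And>i. bounded (U i)" "\<And>i. diameter (U i) \<le> 1/2"
      and sum: "(\<Sum>i. diam_power t (U i)) < ennreal (e / (c + 1))"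
      unfolding hausdorff_premeasure_def by (auto simp: INF_less_iff)
    \<comment> \<open>The \<open>U i\<close> may be non-measurable and need not be centred in
      \<open>S\<close>; these closed balls are Borel and still cover \<open>S\<close>.\<close>
    define V where "V i = (if U i \<inter> S = {} then {} else cball (SOME x. x \<in> U i \<inter> S) (diameter (U i)))" for i
    have pt: "(SOME x. x \<in> U i \<inter> S) \<in> U i \<inter> S" if "U i \<inter> S \<noteq> {}" for i
      using that unfolding some_in_eq .
    have V: "emeasure \<mu> (V i) \<le> ennreal c * diam_power t (U i)" for i
    proof (cases "U i \<inter> S = {}")
      case False
      from pt[OF False] show ?thesis
        using emeasure_le_diam_power[OF sets_mu t growth _ U(2,3)[of i] M, of "SOME x. x \<in> U i \<inter> S"] False
        unfolding V_def c_def by simp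
    qed (simp add: V_def)
    have "S \<subseteq> (\<Union>i. V i)"
    proof
      fix y assume y: "y \<in> S"
      then obtain i where i: "y \<in> U i" using U(1) by blast
      then have "U i \<inter> S \<noteq> {}" using y by blast
      then have "y \<in> V i"
        using pt[of i] i diameter_bounded_bound[OF U(2)[of i], of "SOME x. x \<in> U i \<inter> S" y]
        by (auto simp: V_def)
      then show "y \<in> (\<Union>i. V i)" by blast
    qed
    then have "emeasure \<mu> S \<le> emeasure \<mu> (\<Union>i. V i)"
      by (intro emeasure_mono) (auto simp: sets_mu V_def)
    also have "\<dots> \<le> (\<Sum>i. emeasure \<mu> (V i))"
      by (intro emeasure_subadditive_countably) (auto simp: sets_mu V_def)
    also have "\<dots> \<le> (\<Sum>i. ennreal c * diam_power t (U i))"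
      by (intro suminf_le V) auto
    also have "\<dots> = ennreal c * (\<Sum>i. diam_power t (U i))" by simp
    also have "\<dots> \<le> ennreal c * ennreal (e / (c + 1))"
      using sum by (intro mult_left_mono) auto
    also have "\<dots> \<le> ennreal e"
      using c that by (simp add: field_simps flip: ennreal_mult)
    finally show ?thesis by simp
  qed
  have "emeasure \<mu> S \<le> 0" by (rule ennreal_le_epsilon) (rule small)
  then show ?thesis by simp
qed

lemma hausdorff_measure_mono:
  assumes "A \<subseteq> B"
  shows "hausdorff_measure t A \<le> hausdorff_measure t B"
  unfolding hausdorff_measure_def
proof (rule SUP_mono')
  show "hausdorff_premeasure t \<delta> A \<le> hausdorff_premeasure t \<delta> B" for \<delta>
    unfolding hausdorff_premeasure_def by (rule INF_superset_mono) (use assms in blast)+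
qed

section \<open>From average ball mass to Hausdorff null sets\<close>

lemma borel_measurable_emeasure_ball:
  fixes \<mu> :: "'a :: euclidean_space measure"
  assumes "prob_space \<mu>" and [measurable_cong]: "sets \<mu> = sets borel"
  shows "(\<lambda>x. emeasure \<mu> (ball x r)) \<in> borel_measurable borel"
proof -
  interpret prob_space \<mu> by fact
  have "(\<lambda>x. \<integral>\<^sup>+y. indicator {p. dist (fst p) (snd p) < r} (x, y) \<partial>\<mu>) \<in> borel_measurable borel"
    by measurable
  also have "(\<lambda>x. \<integral>\<^sup>+y. indicator {p. dist (fst p) (snd p) < r} (x, y) \<partial>\<mu>)
      = (\<lambda>x. \<integral>\<^sup>+y. indicator (ball x r) y \<partial>\<mu>)"
    by (intro ext nn_integral_cong) (auto simp: indicator_def)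
  also have "\<dots> = (\<lambda>x. emeasure \<mu> (ball x r))"
    using assms(2) by (intro ext nn_integral_indicator) simp
  finally show ?thesis .
qed

text \<open>The weighted sum \<open>f\<close> of dyadic ball masses has finite integral, because its
  terms integrate to at most a geometric sequence. So \<open>f\<close> is finite almost everywhere,
  which bounds ball growth pointwise.\<close>

lemma emeasure_eq_0_if_hausdorff_null:
  fixes \<mu> :: "'a :: euclidean_space measure"
  assumes prob: "prob_space \<mu>" and sets_mu [measurable_cong]: "sets \<mu> = sets borel"
    and K: "K < \<infinity>" "\<And>r. r > 0 \<Longrightarrow> (\<integral>\<^sup>+x. emeasure \<mu> (ball x r) \<partial>\<mu>) \<le> K * ennreal (r powr s)"
    and t: "0 \<le> t" "t < s"
    and A: "A \<in> sets borel" "hausdorff_measure t A = 0"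
  shows "emeasure \<mu> A = 0"
proof -
  note borel_measurable_emeasure_ball[OF prob sets_mu, measurable]
  define a :: "nat \<Rightarrow> real" where "a k = (1/2) ^ k" for k
  have a: "a k > 0" for k by (simp add: a_def)
  define f where "f x = (\<Sum>k. ennreal (a k powr (-t)) * emeasure \<mu> (ball x (a k)))" for x
  have f [measurable]: "f \<in> borel_measurable borel" unfolding f_def by measurable
  \<comment> \<open>The ratio of that geometric sequence, below 1 because
    \<open>t < s\<close>.\<close>
  define q where "q = (1/2 :: real) powr (s - t)"
  have q: "0 \<le> q" "q < 1" using t by (auto simp: q_def powr01_less_one)
  have "(\<integral>\<^sup>+x. f x \<partial>\<mu>) = (\<Sum>k. ennreal (a k powr (-t)) * (\<integral>\<^sup>+x. emeasure \<mu> (ball x (a k)) \<partial>\<mu>))"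
    unfolding f_def by (simp add: nn_integral_suminf nn_integral_cmult)
  also have "\<dots> \<le> (\<Sum>k. K * ennreal (q ^ k))"
  proof (intro suminf_le summableI)
    fix k
    have "a k powr (-t) * a k powr s = a k powr (s - t)"
      by (simp flip: powr_add)
    also have "\<dots> = q ^ k"
      by (simp add: a_def q_def powr_powr powr_power mult.commute flip: powr_realpow)
    finally have *: "ennreal (a k powr (-t)) * ennreal (a k powr s) = ennreal (q ^ k)"
      by (simp flip: ennreal_mult)
    have "ennreal (a k powr (-t)) * (\<integral>\<^sup>+x. emeasure \<mu> (ball x (a k)) \<partial>\<mu>)
        \<le> ennreal (a k powr (-t)) * (K * ennreal (a k powr s))"
      by (intro mult_left_mono K a) auto
    also have "\<dots> = K * ennreal (q ^ k)"
      using * by (metis mult.left_commute)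
    finally show "ennreal (a k powr (-t)) * (\<integral>\<^sup>+x. emeasure \<mu> (ball x (a k)) \<partial>\<mu>) \<le> K * ennreal (q ^ k)" .
  qed
  also have "\<dots> = K * (\<Sum>k. ennreal (q ^ k))" by simp
  also have "(\<Sum>k. ennreal (q ^ k)) = ennreal (\<Sum>k. q ^ k)"
    using q by (intro suminf_ennreal2 summable_geometric) auto
  also have "K * \<dots> < \<infinity>" using K by (simp add: ennreal_mult_less_top)
  finally have "AE x in \<mu>. f x \<noteq> \<infinity>"
    by (intro nn_integral_PInf_AE) auto
  \<comment> \<open>The mass distribution principle needs one growth constant for the whole set; on
    this sublevel set \<open>n\<close> serves.\<close>
  define S where "S n = {x \<in> A. f x \<le> of_nat n}" for n :: nat
  have S [measurable]: "S n \<in> sets borel" for n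
  proof -
    have "S n = A \<inter> {x \<in> space borel. f x \<le> of_nat n}" by (auto simp: S_def)
    also have "\<dots> \<in> sets borel" using A by measurable
    finally show ?thesis .
  qed
  have "emeasure \<mu> (S n) = 0" for n
  proof (rule null_set_mass_distribution[OF sets_mu t(1), of "real n"])
    fix x k assume x: "x \<in> S n"
    \<comment> \<open>One term of a nonnegative series is at most its sum; multiplying by
      \<open>a k powr t\<close> then isolates the ball mass.\<close>
    have "ennreal (a k powr (-t)) * emeasure \<mu> (ball x (a k)) \<le> f x"
      unfolding f_def using sum_le_suminf[of "\<lambda>k. ennreal (a k powr (-t)) * emeasure \<mu> (ball x (a k))" "{k}"] by simp
    also have "\<dots> \<le> ennreal (real n)" using x by (simp add: S_def ennreal_of_nat_eq_real_of_nat)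
    finally have "ennreal (a k powr t) * (ennreal (a k powr (-t)) * emeasure \<mu> (ball x (a k)))
        \<le> ennreal (a k powr t) * ennreal (real n)"
      by (rule mult_left_mono) simp
    also have "ennreal (a k powr t) * (ennreal (a k powr (-t)) * emeasure \<mu> (ball x (a k)))
        = ennreal (a k powr t * a k powr (-t)) * emeasure \<mu> (ball x (a k))"
      by (simp add: ennreal_mult mult.assoc)
    also have "a k powr t * a k powr (-t) = 1"
      using a[of k] by (simp flip: powr_add)
    also have "ennreal (a k powr t) * ennreal (real n) = ennreal (real n * a k powr t)"
      by (simp add: ennreal_mult mult.commute)
    finally show "emeasure \<mu> (ball x ((1/2) ^ k)) \<le> ennreal (real n * ((1/2) ^ k) powr t)"
      by (simp only: a_def ennreal_1 mult_1)
  next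
    show "hausdorff_measure t (S n) = 0"
      using hausdorff_measure_mono[of "S n" A t] A by (auto simp: S_def)
  qed (simp_all add: S)
  then have "AE x in \<mu>. \<forall>n. x \<notin> S n"
    unfolding AE_all_countable using S by (auto intro!: AE_not_in null_setsI simp: sets_mu)
  with \<open>AE x in \<mu>. f x \<noteq> \<infinity>\<close> have "AE x in \<mu>. x \<notin> A"
  proof eventually_elim
    case (elim x)
    then obtain n :: nat where "f x \<le> of_nat n"
      using ennreal_Ex_less_of_nat[of "f x"] by (auto simp: less_top intro: less_imp_le)
    then show ?case using elim by (auto simp: S_def)
  qed
  then have "emeasure \<mu> {x \<in> space \<mu>. x \<in> A} = 0"
    by (rule emeasure_eq_0_AE)
  then show ?thesis
    by (simp add: sets_eq_imp_space_eq[OF sets_mu])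
qed

lemma fourier_dim_measure_le_hausdorff_dim:
  fixes \<mu> :: "'a :: euclidean_space measure"
  assumes prob: "prob_space \<mu>" and sets_mu: "sets \<mu> = sets borel"
    and A: "A \<in> sets borel" "measure \<mu> A > 0"
  shows "fourier_dim_measure \<mu> \<le> hausdorff_dim A"
  unfolding fourier_dim_measure_def hausdorff_dim_def
proof (intro SUP_least INF_greatest ennreal_leI)
  fix s t assume "s \<in> {s \<in> {0..real DIM('a)}. fourier_decay \<mu> s}"
    and "t \<in> {t. 0 \<le> t \<and> hausdorff_measure t A = 0}"
  then have s: "0 \<le> s" "s \<le> DIM('a)" "fourier_decay \<mu> s"
    and t: "0 \<le> t" "hausdorff_measure t A = 0"
    by auto
  show "s \<le> t"
  proof (rule ccontr)
    assume "\<not> s \<le> t"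
    \<comment> \<open>The midpoint leaves room on both sides: \<open>t < u\<close> makes the dyadic
      series converge, and \<open>u < s\<close> gives \<open>u < d\<close> even when
      \<open>s = d\<close>.\<close>
    define u where "u = (s + t) / 2"
    have u: "t < u" "u < s" "0 \<le> u" "u < DIM('a)"
      using \<open>\<not> s \<le> t\<close> s t by (auto simp: u_def)
    have "fourier_decay \<mu> u"
      using fourier_decay_mono[OF prob sets_mu s(3), of u] u by simp
    then obtain K where "K < \<infinity>"
      "\<And>r. r > 0 \<Longrightarrow> (\<integral>\<^sup>+x. emeasure \<mu> (ball x r) \<partial>\<mu>) \<le> K * ennreal (r powr u)"
      using nn_integral_ball_le[OF prob sets_mu _ u(3,4)] by metis
    then have "emeasure \<mu> A = 0"
      using t u A by (intro emeasure_eq_0_if_hausdorff_null[OF prob sets_mu])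
    then show False using A by (simp add: measure_def)
  qed
qed

section \<open>Monotonicity, countable stability and the comparison of dimensions\<close>

text \<open>\<open>B\<close> is taken Borel because \<open>measure\<close> is 0 on non-measurable
  sets.\<close>

lemma modified_fourier_dim_mono:
  assumes "A \<subseteq> B" "B \<in> sets borel"
  shows "modified_fourier_dim A \<le> modified_fourier_dim B"
  unfolding modified_fourier_dim_def
proof (rule SUP_subset_mono)
  show "{\<mu> \<in> borel_prob_measures. measure \<mu> A > 0} \<subseteq> {\<mu> \<in> borel_prob_measures. measure \<mu> B > 0}"
    using assms
    by (auto simp: borel_prob_measures_def prob_space_def intro: less_le_trans finite_measure.finite_measure_mono)
qed simp

text \<open>A measure that charges the union charges some \<open>A k\<close>. For empty
  \<open>I\<close> both sides are suprema of empty sets, hence 0.\<close>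

lemma modified_fourier_dim_UN:
  assumes "countable I" "\<And>k. k \<in> I \<Longrightarrow> A k \<in> sets borel"
  shows "modified_fourier_dim (\<Union>k\<in>I. A k) = (SUP k\<in>I. modified_fourier_dim (A k))"
proof (rule antisym)
  show "modified_fourier_dim (\<Union>k\<in>I. A k) \<le> (SUP k\<in>I. modified_fourier_dim (A k))"
    unfolding modified_fourier_dim_def[of "\<Union>k\<in>I. A k"]
  proof (rule SUP_least)
    fix \<mu> assume "\<mu> \<in> {\<mu> \<in> borel_prob_measures. measure \<mu> (\<Union>k\<in>I. A k) > 0}"
    then have \<mu>: "\<mu> \<in> borel_prob_measures" "measure \<mu> (\<Union>k\<in>I. A k) > 0"
      and sets_mu: "sets \<mu> = sets borel" and "prob_space \<mu>"
      by (auto simp: borel_prob_measures_def)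
    interpret prob_space \<mu> by fact
    have "\<exists>k\<in>I. measure \<mu> (A k) > 0"
    proof (rule ccontr)
      assume "\<not> (\<exists>k\<in>I. measure \<mu> (A k) > 0)"
      then have "A k \<in> null_sets \<mu>" if "k \<in> I" for k
        using that assms(2)[OF that] by (auto simp: sets_mu emeasure_eq_measure not_less measure_le_0_iff intro!: null_setsI)
      then have "(\<Union>k\<in>I. A k) \<in> null_sets \<mu>"
        using assms(1) by (intro null_sets_UN') auto
      then show False using \<mu>(2) by (simp add: null_setsD1 measure_def)
    qed
    then obtain k where k: "k \<in> I" "measure \<mu> (A k) > 0" by blast
    then have "fourier_dim_measure \<mu> \<le> modified_fourier_dim (A k)"
      unfolding modified_fourier_dim_def using \<mu> by (intro SUP_upper) auto
    also have "\<dots> \<le> (SUP k\<in>I. modified_fourier_dim (A k))"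
      using k by (intro SUP_upper)
    finally show "fourier_dim_measure \<mu> \<le> (SUP k\<in>I. modified_fourier_dim (A k))" .
  qed
  show "(SUP k\<in>I. modified_fourier_dim (A k)) \<le> modified_fourier_dim (\<Union>k\<in>I. A k)"
    using assms by (intro SUP_least modified_fourier_dim_mono sets.countable_UN') auto
qed

lemma fourier_dim_le_modified_fourier_dim: "fourier_dim A \<le> modified_fourier_dim A"
  unfolding fourier_dim_def modified_fourier_dim_def borel_prob_measures_on_def
  by (rule SUP_subset_mono) auto

lemma modified_fourier_dim_le_hausdorff_dim:
  assumes "A \<in> sets borel"
  shows "modified_fourier_dim A \<le> hausdorff_dim A"
  unfolding modified_fourier_dim_def
  using assms
  by (intro SUP_least fourier_dim_measure_le_hausdorff_dim) (auto simp: borel_prob_measures_def)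

theorem theorem17:
  shows "(\<forall>A B :: 'a :: euclidean_space set. A \<in> sets borel \<longrightarrow> B \<in> sets borel \<longrightarrow> A \<subseteq> B \<longrightarrow>
            modified_fourier_dim A \<le> modified_fourier_dim B) \<and>
         (\<forall>(I :: 'i set) (A :: 'i \<Rightarrow> 'a set). countable I \<longrightarrow> (\<forall>k\<in>I. A k \<in> sets borel) \<longrightarrow>
            modified_fourier_dim (\<Union>k\<in>I. A k) = (SUP k\<in>I. modified_fourier_dim (A k))) \<and>
         (\<forall>A :: 'a set. A \<in> sets borel \<longrightarrow>
            fourier_dim A \<le> modified_fourier_dim A \<and> modified_fourier_dim A \<le> hausdorff_dim A)"
  by (intro conjI allI impI)
     (auto intro: modified_fourier_dim_mono modified_fourier_dim_le_hausdorff_dim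
        fourier_dim_le_modified_fourier_dim modified_fourier_dim_UN)

end
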